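(* Let $n \in \mathbb{N}$, $\beta \in \mathbb{R}$, and let $\eta(\boldsymbol{x}) = \sum_{i=1}^n \eta_i(x_i)$ be a scale function on $\mathbb{R}^n$ such that each $\eta_i:\mathbb{R} \to \mathbb{R}_+$, $i \in [n]$, is lower semicontinuous, i.e., $\liminf_{x \to x_0} \eta_i(x) \geq \eta_i(x_0)$ for all $x_0 \in \mathbb{R}$. For $j \in \mathbb{N}$, let $P_j = \prod_{i=1}^n [\ell^i_j, u^i_j]$ be a bounded box, let $\mathcal{F}_j = \{\boldsymbol{x} \in P_j \mid \eta(\boldsymbol{x}) \leq \beta\}$, and let $\mathcal{D}_j$ be the decision diagram constructed by the DD construction algorithm (given in the context) from $\mathcal{F}_j$ using, for each $i \in [n]$, the single sub-interval $[\ell^i_j,u^i_j]$. Assume that $\{P_1,P_2,\dots\}$ is a monotone decreasing sequence, i.e., $P_j \supset P_{j+1}$ for each $j \in \mathbb{N}$, and let $\tilde{\boldsymbol{x}} \in \mathbb{R}^n$ be such that $\{P_j\} \downarrow \{\tilde{\boldsymbol{x}}\}$, i.e., the sequence converges in the Hausdorff sense to the singleton $\{\tilde{\boldsymbol{x}}\}$. Then: (i) If $\eta(\tilde{\boldsymbol{x}}) \leq \beta$, then $\{\operatorname{conv}(\operatorname{Sol}(\mathcal{D}_j))\} \downarrow \{\tilde{\boldsymbol{x}}\}$. (ii) If $\eta(\tilde{\boldsymbol{x}}) > \beta$, then there exists $m \in \mathbb{N}$ such that $\operatorname{Sol}(\mathcal{D}_j) = \emptyset$ for all $j \geq m$.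
   Context: Notation: $[n] = \{1,\dots,n\}$; $\operatorname{conv}$ denotes convex hull. For a sequence of sets in $\mathbb{R}^n$ that is monotone non-increasing, i.e. $Q_1 \supseteq Q_2 \supseteq \cdots$, the notation $\{Q_j\} \downarrow \bar Q$ means that the sequence converges to $\bar Q \subseteq \mathbb{R}^n$ in the Hausdorff sense. In the paper the boxes $P_j$ arise as successive rectangular partitions of the variable domain in a spatial branch-and-cut process. Definition (scale function). A scale function is a function $\eta:\mathbb{R}^n \to \mathbb{R}_+$ of the form $\eta(\boldsymbol{x}) = \sum_{i=1}^n \eta_i(x_i)$, where each $\eta_i:\mathbb{R} \to \mathbb{R}_+ = [0,\infty)$ satisfies: (i) $\eta_i(x) = 0$ if and only if $x = 0$; (ii) $\eta_i(x_1) \leq \eta_i(x_2)$ whenever $0 \leq x_1 \leq x_2$; (iii) $\eta_i(x_1) \geq \eta_i(x_2)$ whenever $x_1 \leq x_2 \leq 0$. Definition (decision diagram, DD). A DD $\mathcal{D} = (\mathcal{U},\mathcal{A},l)$ is a directed acyclic (multi)graph with node layers $\mathcal{U}_1,\dots,\mathcal{U}_{n+1}$, where $\mathcal{U}_1 = \{r\}$ (root) and $\mathcal{U}_{n+1} = \{t\}$ (terminal), arc layers $\mathcal{A}_1,\dots,\mathcal{A}_n$, where each arc in $\mathcal{A}_i$ goes from a node of $\mathcal{U}_i$ to a node of $\mathcal{U}_{i+1}$ (parallel arcs are allowed), and an arc label map $l:\mathcal{A} \to \mathbb{R}$. An $r$-$t$ path $(a_1,\dots,a_n) \in \mathcal{A}_1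 \times \dots \times \mathcal{A}_n$ encodes the point $(l(a_1),\dots,l(a_n)) \in \mathbb{R}^n$. $\operatorname{Sol}(\mathcal{D}) \subseteq \mathbb{R}^n$ is the set of points encoded by all $r$-$t$ paths (empty if there are none). DD construction algorithm. Input: a set $\mathcal{F} = \{\boldsymbol{x} \in \prod_{i=1}^n [\ell^i,u^i] \mid \eta(\boldsymbol{x}) \leq \beta\}$, and for each $i \in [n]$ a finite index set $L_i$ of sub-intervals $[\ell^i_k,u^i_k]$ (with $\ell^i_k \le u^i_k$ real), $k \in L_i$, whose union is $[\ell^i,u^i]$ (in the claim, each $L_i$ has one element and the only sub-interval is the whole domain of $x_i$). For $i \in [n]$, $k \in L_i$, put $$c^i_k = \begin{cases} \eta_i(u^i_k) & \text{if } u^i_k \leq 0,\\ \eta_i(\ell^i_k) & \text{else if } \ell^i_k \geq 0,\\ 0 & \text{otherwise.}\end{cases}$$ 1. Create the root $r$ in $\mathcal{U}_1$ with state value $s(r) = 0$ and the terminal $t$ in $\mathcal{U}_{n+1}$. 2. For $i = 1,\dots,n-1$ in order, for every $u \in \mathcal{U}_i$ and $k \in L_i$: create a node $v$ in $\mathcal{U}_{i+1}$ with state value $s(v) = s(u) + c^i_k$, if no node with this state value exists in $\mathcal{U}_{i+1}$ (otherwise let $v$ be that existing node), and add two arcs from $u$ to $v$ with labels $\ell^i_k$ and $u^i_k$. 3. For every $u \in \mathcal{U}_n$ and $k \in L_n$: compute $\bar s = s(u) + c^n_k$; if $\bar s \leq \beta$, add two arcs from $u$ to $t$ with labels $\ell^n_k$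 and $u^n_k$. *)

theory Defs
  imports "HOL-Analysis.Analysis"
begin

subsection \<open>Coordinates\<close>

text \<open>Layers of a decision diagram are numbered by naturals, coordinates of \<open>real ^ 'n\<close> by
  the elements of \<open>'n\<close>. The linear order of \<open>'n\<close> identifies \<open>'n\<close> with \<open>{1..CARD('n)}\<close>:
  \<open>coord i\<close> is the \<open>i\<close>-th smallest index (junk outside \<open>{1..CARD('n)}\<close>).\<close>

definition coord :: "nat \<Rightarrow> 'n::{finite,linorder}" where
  "coord i = sorted_list_of_set (UNIV :: 'n set) ! (i - 1)"

lemma bij_betw_coord:
  "bij_betw coord {1..CARD('n)} (UNIV :: 'n::{finite,linorder} set)"
proof -
  let ?xs = "sorted_list_of_set (UNIV :: 'n set)"
  have "bij_betw (\<lambda>i. i - 1) {1..CARD('n)} {..<CARD('n)}"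
    by (rule bij_betw_byWitness[where f' = Suc]) auto
  moreover have "bij_betw ((!) ?xs) {..<CARD('n)} (UNIV :: 'n set)"
    by (rule bij_betw_nth) auto
  ultimately have "bij_betw ((!) ?xs \<circ> (\<lambda>i. i - 1)) {1..CARD('n)} (UNIV :: 'n set)"
    by (rule bij_betw_trans)
  then show ?thesis
    by (simp add: coord_def comp_def cong: bij_betw_cong)
qed


subsection \<open>Scale functions\<close>

definition scale_component :: "(real \<Rightarrow> real) \<Rightarrow> bool" where
  "scale_component f \<longleftrightarrow>
     (\<forall>x. 0 \<le> f x) \<and>
     (\<forall>x. f x = 0 \<longleftrightarrow> x = 0) \<and>
     (\<forall>x y. 0 \<le> x \<and> x \<le> y \<longrightarrow> f x \<le> f y) \<and>
     (\<forall>x y. x \<le> y \<and> y \<le> 0 \<longrightarrow> f y \<le> f x)"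

definition scale_function :: "('n::finite \<Rightarrow> real \<Rightarrow> real) \<Rightarrow> (real ^ 'n \<Rightarrow> real) \<Rightarrow> bool" where
  "scale_function \<eta>s \<eta> \<longleftrightarrow>
     (\<forall>i. scale_component (\<eta>s i)) \<and> (\<forall>x. \<eta> x = (\<Sum>i\<in>UNIV. \<eta>s i (x $ i)))"

definition lower_semicontinuous :: "(real \<Rightarrow> real) \<Rightarrow> bool" where
  "lower_semicontinuous f \<longleftrightarrow> (\<forall>x0. Liminf (at x0) (\<lambda>x. ereal (f x)) \<ge> ereal (f x0))"


subsection \<open>Hausdorff convergence\<close>

text \<open>With values in \<open>ennreal\<close>, the distance between the empty set and a nonempty set is
  \<open>\<infinity>\<close>, so a sequence converging to a nonempty set is eventually nonempty.\<close>

definition hausdorff_distance :: "'a::metric_space set \<Rightarrow> 'a set \<Rightarrow> ennreal" where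
  "hausdorff_distance A B =
     max (SUP a\<in>A. INF b\<in>B. ennreal (dist a b)) (SUP b\<in>B. INF a\<in>A. ennreal (dist a b))"

definition hausdorff_decreases_to ::
    "(nat \<Rightarrow> 'a::metric_space set) \<Rightarrow> 'a set \<Rightarrow> bool" (infix "\<down>" 50) where
  "Q \<down> Qbar \<longleftrightarrow> decseq Q \<and> (\<lambda>j. hausdorff_distance (Q j) Qbar) \<longlonglongrightarrow> 0"


subsection \<open>Decision diagrams\<close>

record ('v, 'a) dd =
  node_layer :: "nat \<Rightarrow> 'v set"
  arc_layer :: "nat \<Rightarrow> 'a set"
  root :: 'v
  terminal :: 'v
  tail :: "'a \<Rightarrow> 'v"
  head :: "'a \<Rightarrow> 'v"
  label :: "'a \<Rightarrow> real"

text \<open>Acyclicity is implied, since the node layers are disjoint and every arc leads from one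
  layer to the next.\<close>

definition decision_diagram :: "nat \<Rightarrow> ('v, 'a) dd \<Rightarrow> bool" where
  "decision_diagram n D \<longleftrightarrow>
     n \<ge> 1 \<and>
     node_layer D 1 = {root D} \<and> node_layer D (n + 1) = {terminal D} \<and>
     disjoint_family_on (node_layer D) {1..n + 1} \<and>
     disjoint_family_on (arc_layer D) {1..n} \<and>
     (\<forall>i\<in>{1..n}. \<forall>a\<in>arc_layer D i. tail D a \<in> node_layer D i \<and> head D a \<in> node_layer D (i + 1))"

definition root_terminal_path :: "nat \<Rightarrow> ('v, 'a) dd \<Rightarrow> (nat \<Rightarrow> 'a) \<Rightarrow> bool" where
  "root_terminal_path n D a \<longleftrightarrow>
     (\<forall>i\<in>{1..n}. a i \<in> arc_layer D i) \<and>
     tail D (a 1) = root D \<and>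
     (\<forall>i\<in>{1..<n}. head D (a i) = tail D (a (i + 1))) \<and>
     head D (a n) = terminal D"

definition Sol :: "('v, 'a) dd \<Rightarrow> (real ^ 'n::{finite,linorder}) set" where
  "Sol D = {x. \<exists>a. root_terminal_path CARD('n) D a \<and>
                   (\<forall>i\<in>{1..CARD('n)}. x $ coord i = label D (a i))}"


subsection \<open>Construction of a decision diagram\<close>

text \<open>Within a layer nodes are determined by their state values, so a node is represented by its
  layer and its state value. The root is \<open>State 1 0\<close>. \<open>Arc i s k e\<close> leaves the node
  \<open>State i s\<close> and belongs to the \<open>k\<close>-th sub-interval of the \<open>i\<close>-th coordinate; its label is the
  lower or the upper end of that sub-interval, as given by \<open>e\<close>.\<close>

datatype dd_node = State nat real | Terminal

datatype endpoint = Lower | Upper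

datatype 'k dd_arc = Arc nat real 'k endpoint

definition arc_cost :: "(real \<Rightarrow> real) \<Rightarrow> real \<Rightarrow> real \<Rightarrow> real" where
  "arc_cost f lo hi = (if hi \<le> 0 then f hi else if lo \<ge> 0 then f lo else 0)"

text \<open>The state values occurring in layer \<open>i\<close>, for \<open>i \<in> {1..CARD('n)}\<close>. Since this is a set,
  a state value that is reached repeatedly yields only one node.\<close>

fun layer_states ::
    "('n::{finite,linorder} \<Rightarrow> real \<Rightarrow> real) \<Rightarrow> ('n \<Rightarrow> 'k set) \<Rightarrow>
     ('n \<Rightarrow> 'k \<Rightarrow> real) \<Rightarrow> ('n \<Rightarrow> 'k \<Rightarrow> real) \<Rightarrow> nat \<Rightarrow> real set" where
  "layer_states \<eta>s L lo hi 0 = {}"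
| "layer_states \<eta>s L lo hi (Suc 0) = {0}"
| "layer_states \<eta>s L lo hi (Suc (Suc i)) =
     (let m = coord (Suc i) in
      {s + arc_cost (\<eta>s m) (lo m k) (hi m k) | s k. s \<in> layer_states \<eta>s L lo hi (Suc i) \<and> k \<in> L m})"

text \<open>The input \<open>{x. (\<forall>m. x $ m \<in> (\<Union>k\<in>L m. {lo m k..hi m k})) \<and> (\<Sum>m\<in>UNIV. \<eta>s m (x $ m)) \<le> \<beta>}\<close>
  is given through \<open>\<eta>s\<close>, \<open>\<beta>\<close> and the sub-intervals \<open>[lo m k, hi m k]\<close>, \<open>k \<in> L m\<close>.\<close>

definition construct_dd ::
    "('n::{finite,linorder} \<Rightarrow> real \<Rightarrow> real) \<Rightarrow> real \<Rightarrow> ('n \<Rightarrow> 'k set) \<Rightarrow>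
     ('n \<Rightarrow> 'k \<Rightarrow> real) \<Rightarrow> ('n \<Rightarrow> 'k \<Rightarrow> real) \<Rightarrow> (dd_node, 'k dd_arc) dd" where
  "construct_dd \<eta>s \<beta> L lo hi =
     (let n = CARD('n);
          c = (\<lambda>i k. arc_cost (\<eta>s (coord i)) (lo (coord i) k) (hi (coord i) k))
      in \<lparr> node_layer = (\<lambda>i. if i \<in> {1..n} then State i ` layer_states \<eta>s L lo hi i
                             else if i = n + 1 then {Terminal} else {}),
           arc_layer = (\<lambda>i. if i \<in> {1..n}
                            then {Arc i s k e | s k e. s \<in> layer_states \<eta>s L lo hi i \<and>
                                    k \<in> L (coord i) \<and> (i = n \<longrightarrow> s + c i k \<le> \<beta>)}
                            else {}),
           root = State 1 0,
           terminal = Terminal,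
           tail = (\<lambda>a. case a of Arc i s k e \<Rightarrow> State i s),
           head = (\<lambda>a. case a of Arc i s k e \<Rightarrow>
                         if i < n then State (i + 1) (s + c i k) else Terminal),
           label = (\<lambda>a. case a of Arc i s k e \<Rightarrow>
                         (case e of Lower \<Rightarrow> lo (coord i) k | Upper \<Rightarrow> hi (coord i) k)) \<rparr>)"

lemma decision_diagram_construct_dd:
  fixes \<eta>s :: "'n::{finite,linorder} \<Rightarrow> real \<Rightarrow> real"
  shows "decision_diagram CARD('n) (construct_dd \<eta>s \<beta> L lo hi)"
proof -
  have step: "s + arc_cost (\<eta>s (coord i)) (lo (coord i) k) (hi (coord i) k)
                \<in> layer_states \<eta>s L lo hi (Suc i)"
    if "i \<ge> 1" "s \<in> layer_states \<eta>s L lo hi i" "k \<in> L (coord i)" for i s k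
    using that by (cases i) (auto simp: Let_def)
  have "CARD('n) \<ge> 1"
    by (simp add: Suc_leI)
  then show ?thesis
    unfolding decision_diagram_def construct_dd_def Let_def
    by (auto simp: disjoint_family_on_def not_less_eq_eq intro!: imageI step)
qed

text \<open>The diagram obtained for the box \<open>cbox l u\<close> when every coordinate has its whole domain as
  the only sub-interval.\<close>

definition box_dd ::
    "('n::{finite,linorder} \<Rightarrow> real \<Rightarrow> real) \<Rightarrow> real \<Rightarrow>
     real ^ 'n::{finite,linorder} \<Rightarrow> real ^ 'n::{finite,linorder} \<Rightarrow>
     (dd_node, unit dd_arc) dd" where
  "box_dd \<eta>s \<beta> l u = construct_dd \<eta>s \<beta> (\<lambda>_. {()}) (\<lambda>m _. l $ m) (\<lambda>m _. u $ m)"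

end

theory Submission
  imports Defs
begin

text \<open>With one sub-interval per coordinate every layer before the terminal has a single node, so all
  root-terminal paths share one total cost, the sum of the arc costs of the coordinates. The last
  layer either admits all paths or none. Hence the solution set is all corners of the box if the
  total cost is at most \<open>\<beta>\<close>, and empty otherwise (\<open>Sol_box_dd\<close>); in the first case its convex hull
  is the box itself (\<open>convex_hull_box_vertices\<close>). Both parts therefore reduce to comparing the
  total cost with \<open>\<beta>\<close>.

  The arc cost of an interval is the minimum of the scale component over it (\<open>arc_cost_attained\<close>,
  \<open>arc_cost_le\<close>). The limit point \<open>xt\<close> lies in every box, so the total cost never exceeds
  \<open>\<eta> xt\<close>. If \<open>\<eta> xt \<le> \<beta>\<close>, the hulls are thus exactly the boxes, which decrease to \<open>{xt}\<close>.
  If \<open>\<eta> xt > \<beta>\<close>, the minimisers in the shrinking intervals converge to the coordinates of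
  \<open>xt\<close>, and lower semicontinuity brings the total cost eventually above every number below
  \<open>\<eta> xt\<close> (\<open>arc_cost_eventually_greater\<close>), in particular above \<open>\<beta>\<close>.\<close>

text \<open>If neither sign condition of the arc cost applies, the interval contains \<open>0\<close>, where the
  scale component vanishes. With \<open>arc_cost_le\<close> below this identifies the arc cost as the minimum
  over the interval.\<close>

lemma arc_cost_attained:
  assumes "scale_component f" "lo \<le> hi"
  shows "\<exists>y\<in>{lo..hi}. arc_cost f lo hi = f y"
proof -
  have "f 0 = 0"
    using assms(1) by (simp add: scale_component_def)
  then show ?thesis
    using assms(2) unfolding arc_cost_def by (cases "hi \<le> 0"; cases "lo \<ge> 0"; force)
qed

lemma arc_cost_le:
  assumes "scale_component f" "lo \<le> x" "x \<le> hi"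
  shows "arc_cost f lo hi \<le> f x"
proof -
  have f: "0 \<le> f x" "\<And>x y. 0 \<le> x \<Longrightarrow> x \<le> y \<Longrightarrow> f x \<le> f y"
    "\<And>x y. x \<le> y \<Longrightarrow> y \<le> 0 \<Longrightarrow> f y \<le> f x"
    using assms(1) unfolding scale_component_def by blast+
  show ?thesis
    using f(1) f(2)[of lo x] f(3)[of x hi] assms(2,3) by (simp add: arc_cost_def)
qed

text \<open>The limit inferior in the definition of lower semicontinuity ignores the value at the point;
  the sequences used later may hit the limit point, so full neighbourhoods are needed.\<close>

lemma lower_semicontinuous_eventually_less:
  assumes "lower_semicontinuous f" "c < f x0"
  shows "\<forall>\<^sub>F x in nhds x0. c < f x"
proof -
  have "ereal c < Liminf (at x0) (\<lambda>x. ereal (f x))"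
    using assms by (auto simp: lower_semicontinuous_def intro: less_le_trans[of _ "ereal (f x0)"])
  then have "\<forall>\<^sub>F x in at x0. c < f x"
    by (auto dest: less_LiminfD)
  with assms(2) show ?thesis
    by (auto simp: eventually_at_filter elim: eventually_mono)
qed

text \<open>The arc cost is the value of \<open>f\<close> at some point of the interval, and such points are squeezed
  to \<open>x\<close>; lower semicontinuity at \<open>x\<close> does the rest.\<close>

lemma arc_cost_eventually_greater:
  assumes "scale_component f" "lower_semicontinuous f" "c < f x"
    and "\<And>j. lo j \<le> hi j" "lo \<longlonglongrightarrow> x" "hi \<longlonglongrightarrow> x"
  shows "\<forall>\<^sub>F j in sequentially. c < arc_cost f (lo j) (hi j)"
proof -
  have "\<forall>j. \<exists>y. lo j \<le> y \<and> y \<le> hi j \<and> arc_cost f (lo j) (hi j) = f y"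
    using arc_cost_attained[OF assms(1,4)] by force
  then obtain y where y:
    "\<And>j. lo j \<le> y j" "\<And>j. y j \<le> hi j" "\<And>j. arc_cost f (lo j) (hi j) = f (y j)"
    by metis
  have "y \<longlonglongrightarrow> x"
    using assms(5,6) y(1,2) by (intro tendsto_sandwich[of lo y _ hi]) auto
  then show ?thesis
    using eventually_compose_filterlim[OF lower_semicontinuous_eventually_less[OF assms(2,3)]]
    by (simp add: y(3))
qed

lemma decreases_to_singleton_tendsto:
  assumes "Q \<down> {x}" "\<And>j. a j \<in> Q j"
  shows "a \<longlonglongrightarrow> x"
proof -
  have "ennreal (dist (a j) x) \<le> hausdorff_distance (Q j) {x}" for j
    using assms(2)[of j] unfolding hausdorff_distance_def
    by (auto intro!: max.coboundedI1 SUP_upper)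
  moreover have "(\<lambda>j. hausdorff_distance (Q j) {x}) \<longlonglongrightarrow> 0"
    using assms(1) by (simp add: hausdorff_decreases_to_def)
  ultimately have "(\<lambda>j. ennreal (dist (a j) x)) \<longlonglongrightarrow> ennreal 0"
    using tendsto_sandwich[OF always_eventually always_eventually tendsto_const, of 0]
    by (metis (no_types, lifting) ennreal_0 zero_le)
  then have "(\<lambda>j. dist (a j) x) \<longlonglongrightarrow> 0"
    by (rule iffD1[OF tendsto_ennreal_iff, rotated -1]) (simp_all add: always_eventually)
  then show ?thesis
    by (rule iffD2[OF tendsto_dist_iff])
qed

text \<open>By monotonicity, every tail of a sequence of selected points stays in \<open>Q j\<close>, which is closed
  and so contains the limit.\<close>

lemma decreases_to_singleton_mem:
  assumes "Q \<down> {x}" "\<And>j. closed (Q j)" "\<And>j. Q j \<noteq> {}"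
  shows "x \<in> Q j"
proof -
  obtain a where a: "\<And>j. a j \<in> Q j"
    using assms(3) by (meson ex_in_conv)
  have "(\<lambda>k. a (k + j)) \<longlonglongrightarrow> x"
    using decreases_to_singleton_tendsto[OF assms(1) a] by (rule LIMSEQ_ignore_initial_segment)
  moreover have "a (k + j) \<in> Q j" for k
    using a[of "k + j"] assms(1) unfolding hausdorff_decreases_to_def
    using decseqD[of Q j "k + j"] by auto
  ultimately show ?thesis
    using closed_sequentially[OF assms(2), of "\<lambda>k. a (k + j)"] by blast
qed

definition box_vertices :: "real ^ 'n \<Rightarrow> real ^ 'n \<Rightarrow> (real ^ 'n) set" where
  "box_vertices l u = {x. \<forall>i. x $ i = l $ i \<or> x $ i = u $ i}"

text \<open>By the Krein-Milman theorem it suffices that extreme points of the box are corners: a point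
  with a coordinate strictly between its bounds is the midpoint of a segment in the box that is
  parallel to that axis.\<close>

lemma convex_hull_box_vertices:
  fixes l u :: "real ^ 'n"
  assumes "\<And>i. l $ i \<le> u $ i"
  shows "convex hull box_vertices l u = cbox l u"
proof
  have "l $ i \<le> x $ i \<and> x $ i \<le> u $ i" if "x \<in> box_vertices l u" for x i
  proof -
    have "x $ i = l $ i \<or> x $ i = u $ i"
      using that by (simp add: box_vertices_def)
    then show ?thesis
      using assms[of i] by auto
  qed
  then have "box_vertices l u \<subseteq> cbox l u"
    by (auto simp: mem_box_cart)
  then show "convex hull box_vertices l u \<subseteq> cbox l u"
    by (simp add: hull_minimal)
  have "x \<in> box_vertices l u" if x: "x extreme_point_of cbox l u" for x
  proof (rule ccontr)
    assume "x \<notin> box_vertices l u"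
    then obtain i where i: "x $ i \<noteq> l $ i" "x $ i \<noteq> u $ i"
      by (auto simp: box_vertices_def)
    define d where "d = min (x $ i - l $ i) (u $ i - x $ i)"
    have box: "l $ k \<le> x $ k" "x $ k \<le> u $ k" for k
      using x by (simp_all add: extreme_point_of_def mem_box_cart)
    have d: "d > 0"
      using i box[of i] by (simp add: d_def)
    have fits: "l $ i \<le> x $ i - d" "x $ i + d \<le> u $ i"
      by (simp_all add: d_def)
    have "x - axis i d \<in> cbox l u" "x + axis i d \<in> cbox l u"
      using box fits d by (simp_all add: mem_box_cart axis_def add_increasing2 diff_le_eq)
    moreover have "x \<in> open_segment (x - axis i d) (x + axis i d)"
    proof -
      have "x - axis i d \<noteq> x + axis i d"
        using d by (simp add: vec_eq_iff axis_def exI[of _ i])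
      moreover have "x = midpoint (x - axis i d) (x + axis i d)"
        by (simp add: midpoint_def vec_eq_iff)
      ultimately show ?thesis
        using midpoint_in_open_segment[of "x - axis i d" "x + axis i d"] by simp
    qed
    ultimately show False
      using x unfolding extreme_point_of_def by blast
  qed
  then have "convex hull {x. x extreme_point_of cbox l u} \<subseteq> convex hull box_vertices l u"
    by (intro hull_mono) auto
  then show "cbox l u \<subseteq> convex hull box_vertices l u"
    using Krein_Milman_Minkowski[OF compact_cbox convex_box(1), of l u] by simp
qed

text \<open>Each layer holds the single state \<open>S i\<close>, the cost of the coordinates before \<open>i\<close>. From each
  node both end points are available as labels, independently of the other layers, and the
  test at the last layer compares the total cost with \<open>\<beta>\<close>.\<close>

lemma Sol_box_dd:
  fixes \<eta>s :: "'n::{finite,linorder} \<Rightarrow> real \<Rightarrow> real" and l u :: "real ^ 'n::{finite,linorder}"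
  shows "Sol (box_dd \<eta>s \<beta> l u) =
    (if (\<Sum>m\<in>UNIV. arc_cost (\<eta>s m) (l $ m) (u $ m)) \<le> \<beta> then box_vertices l u else {})"
proof -
  let ?n = "CARD('n)"
  let ?D = "box_dd \<eta>s \<beta> l u"
  let ?L = "\<lambda>_ :: 'n. {()}" and ?lo = "\<lambda>m _. l $ m" and ?hi = "\<lambda>m _. u $ m"
  define c where "c i = arc_cost (\<eta>s (coord i)) (l $ coord i) (u $ coord i)" for i
  define S where "S i = (\<Sum>k\<in>{1..<i}. c k)" for i
  have n: "?n \<ge> 1"
    by (simp add: Suc_leI)
  have S_Suc: "S (i + 1) = S i + c i" if "i \<ge> 1" for i
    using that by (simp add: S_def)
  have layer: "layer_states \<eta>s ?L ?lo ?hi (Suc i) = {S (Suc i)}" for i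
    by (induction i) (simp_all add: S_def c_def Let_def)
  have total: "(\<Sum>m\<in>UNIV. arc_cost (\<eta>s m) (l $ m) (u $ m)) = S ?n + c ?n"
  proof -
    have "(\<Sum>m\<in>UNIV. arc_cost (\<eta>s m) (l $ m) (u $ m)) = (\<Sum>i\<in>{1..?n}. c i)"
      unfolding c_def by (rule sum.reindex_bij_betw[OF bij_betw_coord, symmetric])
    also have "{1..?n} = {1..<?n + 1}"
      by auto
    finally show ?thesis
      using S_Suc[OF n] by (simp add: S_def)
  qed
  have arcs: "arc_layer ?D i = {Arc i (S i) () e | e. i = ?n \<longrightarrow> S ?n + c ?n \<le> \<beta>}"
    if "i \<in> {1..?n}" for i
  proof -
    have "layer_states \<eta>s ?L ?lo ?hi i = {S i}"
      using layer[of "i - 1"] that by simp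
    then show ?thesis
      using that by (auto simp: box_dd_def construct_dd_def Let_def c_def)
  qed
  have labels: "label ?D (Arc i s k e) = (case e of Lower \<Rightarrow> l $ coord i | Upper \<Rightarrow> u $ coord i)"
    for i s k e
    by (simp add: box_dd_def construct_dd_def Let_def)
  have ends: "tail ?D (Arc i s k e) = State i s" "root ?D = State 1 0" "terminal ?D = Terminal"
      "head ?D (Arc i s k e) = (if i < ?n then State (i + 1) (s + c i) else Terminal)" for i s k e
    by (simp_all add: box_dd_def construct_dd_def c_def Let_def)
  have coord_cover: "\<exists>i\<in>{1..?n}. m = coord i" for m :: 'n
    using bij_betw_coord[where 'n = 'n] by (auto simp: bij_betw_def)
  have "x \<in> Sol ?D \<longleftrightarrow> S ?n + c ?n \<le> \<beta> \<and> x \<in> box_vertices l u" for x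
  proof
    assume "x \<in> Sol ?D"
    then obtain a where a: "\<forall>i\<in>{1..?n}. a i \<in> arc_layer ?D i"
      and x: "\<forall>i\<in>{1..?n}. x $ coord i = label ?D (a i)"
      by (auto simp: Sol_def root_terminal_path_def)
    have "x $ m = l $ m \<or> x $ m = u $ m" for m
    proof -
      obtain i where i: "i \<in> {1..?n}" "m = coord i"
        using coord_cover by blast
      then have "a i \<in> arc_layer ?D i"
        using a by blast
      then obtain e where "a i = Arc i (S i) () e"
        using arcs[OF i(1)] by auto
      then show ?thesis
        using x i by (cases e) (auto simp: labels)
    qed
    moreover have "a ?n \<in> arc_layer ?D ?n"
      using a n by simp
    then have "S ?n + c ?n \<le> \<beta>"
      using arcs[of ?n] n by auto
    ultimately show "S ?n + c ?n \<le> \<beta> \<and> x \<in> box_vertices l u"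
      by (simp add: box_vertices_def)
  next
    assume R: "S ?n + c ?n \<le> \<beta> \<and> x \<in> box_vertices l u"
    define a where
      "a i = Arc i (S i) () (if x $ coord i = l $ coord i then Lower else Upper)" for i
    have "root_terminal_path ?n ?D a"
      using R S_Suc by (auto simp: root_terminal_path_def a_def arcs ends) (simp add: S_def)
    moreover have "x $ coord i = label ?D (a i)" for i
      using R by (auto simp: a_def labels box_vertices_def)
    ultimately show "x \<in> Sol ?D"
      by (auto simp: Sol_def)
  qed
  then show ?thesis
    by (auto simp: total)
qed

theorem proposition7:
  fixes \<eta>s :: "'n::{finite,linorder} \<Rightarrow> real \<Rightarrow> real"
    and \<eta> :: "real ^ 'n::{finite,linorder} \<Rightarrow> real"
    and \<beta> :: real
    and l u :: "nat \<Rightarrow> real ^ 'n::{finite,linorder}"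
    and xt :: "real ^ 'n::{finite,linorder}"
  assumes "scale_function \<eta>s \<eta>"
    and "\<And>i. lower_semicontinuous (\<eta>s i)"
    and "\<And>j i. l j $ i \<le> u j $ i"
    and "\<And>j. cbox (l (Suc j)) (u (Suc j)) \<subseteq> cbox (l j) (u j)"
    and "(\<lambda>j. cbox (l j) (u j)) \<down> {xt}"
  shows "(\<eta> xt \<le> \<beta> \<longrightarrow>
            (\<lambda>j. convex hull Sol (box_dd \<eta>s \<beta> (l j) (u j))) \<down> {xt}) \<and>
         (\<eta> xt > \<beta> \<longrightarrow>
            (\<exists>m. \<forall>j\<ge>m. Sol (box_dd \<eta>s \<beta> (l j) (u j)) = ({} :: (real ^ 'n::{finite,linorder}) set)))"
proof (intro conjI impI)
  have component: "scale_component (\<eta>s i)" for i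
    using assms(1) by (simp add: scale_function_def)
  have \<eta>: "\<eta> x = (\<Sum>i\<in>UNIV. \<eta>s i (x $ i))" for x
    using assms(1) by (simp add: scale_function_def)
  have corners: "l j \<in> cbox (l j) (u j)" "u j \<in> cbox (l j) (u j)" for j
    using assms(3) by (auto simp: mem_box_cart)
  let ?cost = "\<lambda>j. \<Sum>i\<in>UNIV. arc_cost (\<eta>s i) (l j $ i) (u j $ i)"
  {
    assume le: "\<eta> xt \<le> \<beta>"
    have "xt \<in> cbox (l j) (u j)" for j
      using corners by (intro decreases_to_singleton_mem[OF assms(5)]) auto
    then have "?cost j \<le> \<eta> xt" for j
      unfolding \<eta> by (intro sum_mono arc_cost_le component) (auto simp: mem_box_cart)
    with le have "?cost j \<le> \<beta>" for j
      by (meson order_trans)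
    then show "(\<lambda>j. convex hull Sol (box_dd \<eta>s \<beta> (l j) (u j))) \<down> {xt}"
      using assms(5) by (simp add: Sol_box_dd convex_hull_box_vertices assms(3))
  next
    assume gt: "\<eta> xt > \<beta>"
    \<comment> \<open>The excess over \<open>\<beta>\<close> is spread evenly over the coordinates.\<close>
    define \<delta> where "\<delta> = (\<eta> xt - \<beta>) / CARD('n)"
    have \<delta>: "\<delta> > 0"
      using gt by (simp add: \<delta>_def)
    have lim: "l \<longlonglongrightarrow> xt" "u \<longlonglongrightarrow> xt"
      using decreases_to_singleton_tendsto[OF assms(5)] corners by blast+
    have "\<forall>\<^sub>F j in sequentially. \<eta>s i (xt $ i) - \<delta> < arc_cost (\<eta>s i) (l j $ i) (u j $ i)" for i
      using \<delta> lim by (intro arc_cost_eventually_greater[OF component assms(2), where x = "xt $ i"]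
          assms(3) tendsto_vec_nth) auto
    then have "\<forall>\<^sub>F j in sequentially.
        \<forall>i. \<eta>s i (xt $ i) - \<delta> < arc_cost (\<eta>s i) (l j $ i) (u j $ i)"
      by (rule eventually_all_finite)
    then obtain m where m:
      "\<And>j i. j \<ge> m \<Longrightarrow> \<eta>s i (xt $ i) - \<delta> < arc_cost (\<eta>s i) (l j $ i) (u j $ i)"
      by (auto simp: eventually_sequentially)
    have "\<not> ?cost j \<le> \<beta>" if "j \<ge> m" for j
    proof -
      have "\<beta> = (\<Sum>i\<in>UNIV. \<eta>s i (xt $ i) - \<delta>)"
        by (simp add: sum_subtractf \<eta> \<delta>_def)
      also have "\<dots> < ?cost j"
        using m[OF that] by (intro sum_strict_mono) auto
      finally show ?thesis
        by simp
    qed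
    then show "\<exists>m. \<forall>j\<ge>m. Sol (box_dd \<eta>s \<beta> (l j) (u j)) = ({} :: (real ^ 'n::{finite,linorder}) set)"
      by (auto simp: Sol_box_dd)
  }
qed

end
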